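(* Let $c\in(0,1]$ and let $X$ be a separable Banach space whose norm is $c$-Lipschitz weak-star Kadec-Klee. Then for every $\varepsilon>0$ there is a closed linear subspace $E$ of $c_0(\mathbb N)$ with $d_{BM}(X,E)\le \frac1{c^2}+\varepsilon$.
   Context: For a separable Banach space $X$ and $c\in(0,1]$, the norm of $X$ is called $c$-Lipschitz weak-star Kadec-Klee ($c$-$LKK^*$) if its dual norm satisfies: for every $x^*\in X^*$ and every weak$^*$-null sequence $(x_n^* )$ in $X^*$, $\limsup_n\|x^*+x_n^*\|\ge \|x^*\|+c\,\limsup_n\|x_n^*\|$. $d_{BM}(X,E)=\inf\{\|T\|\,\|T^{-1}\|: T:X\to E \text{ linear isomorphism onto}\}$ is the Banach-Mazur distance. *)

theory Defs
  imports "HOL-Analysis.Analysis" "HOL-Library.Liminf_Limsup"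
begin

(* Real Banach spaces are modelled by types of class banach; the dual space X* is
  the type of bounded linear functionals 'a =>L real with its operator norm. *)

definition separable_space :: "'a::metric_space itself \<Rightarrow> bool" where
  "separable_space _ \<longleftrightarrow> (\<exists>D::'a set. countable D \<and> closure D = UNIV)"

definition weak_star_null :: "(nat \<Rightarrow> ('a::real_normed_vector \<Rightarrow>\<^sub>L real)) \<Rightarrow> bool" where
  "weak_star_null xs \<longleftrightarrow> (\<forall>x. (\<lambda>n. blinfun_apply (xs n) x) \<longlonglongrightarrow> 0)"

definition c_LKK_star :: "real \<Rightarrow> 'a::real_normed_vector itself \<Rightarrow> bool" where
  "c_LKK_star c _ \<longleftrightarrow>
     (\<forall>(f::'a \<Rightarrow>\<^sub>L real) xs. weak_star_null xs \<longrightarrow>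
        limsup (\<lambda>n. ereal (norm (f + xs n)))
          \<ge> ereal (norm f) + ereal c * limsup (\<lambda>n. ereal (norm (xs n))))"

definition c0 :: "(nat \<Rightarrow> real) set" where
  "c0 = {f. f \<longlonglongrightarrow> 0}"

definition c0_norm :: "(nat \<Rightarrow> real) \<Rightarrow> real" where
  "c0_norm f = (SUP n. \<bar>f n\<bar>)"

definition c0_linear_subspace :: "(nat \<Rightarrow> real) set \<Rightarrow> bool" where
  "c0_linear_subspace E \<longleftrightarrow> E \<subseteq> c0 \<and> (\<lambda>n. 0) \<in> E \<and>
     (\<forall>f\<in>E. \<forall>g\<in>E. (\<lambda>n. f n + g n) \<in> E) \<and>
     (\<forall>a f. f \<in> E \<longrightarrow> (\<lambda>n. a * f n) \<in> E)"

definition c0_closed :: "(nat \<Rightarrow> real) set \<Rightarrow> bool" where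
  "c0_closed E \<longleftrightarrow> (\<forall>g f. (\<forall>k. g k \<in> E) \<and> f \<in> c0 \<and>
       (\<lambda>k. c0_norm (\<lambda>n. g k n - f n)) \<longlonglongrightarrow> 0 \<longrightarrow> f \<in> E)"

definition linear_to_seq :: "('a::real_vector \<Rightarrow> (nat \<Rightarrow> real)) \<Rightarrow> bool" where
  "linear_to_seq T \<longleftrightarrow> (\<forall>x y. T (x + y) = (\<lambda>n. T x n + T y n)) \<and>
     (\<forall>a x. T (a *\<^sub>R x) = (\<lambda>n. a * T x n))"

definition opnorm_to_c0 :: "('a::real_normed_vector \<Rightarrow> (nat \<Rightarrow> real)) \<Rightarrow> ereal" where
  "opnorm_to_c0 T = (SUP x \<in> {x. norm x \<le> 1}. ereal (c0_norm (T x)))"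

definition opnorm_from_c0 :: "(nat \<Rightarrow> real) set \<Rightarrow> ((nat \<Rightarrow> real) \<Rightarrow> 'a::real_normed_vector) \<Rightarrow> ereal" where
  "opnorm_from_c0 E S = (SUP y \<in> {y \<in> E. c0_norm y \<le> 1}. ereal (norm (S y)))"

definition bm_dist_c0 :: "'a::real_normed_vector itself \<Rightarrow> (nat \<Rightarrow> real) set \<Rightarrow> ereal" where
  "bm_dist_c0 _ E = (INF T \<in> {T::'a \<Rightarrow> (nat \<Rightarrow> real). linear_to_seq T \<and> bij_betw T UNIV E}.
       opnorm_to_c0 T * opnorm_from_c0 E (inv_into UNIV T))"

end

theory Submission
  imports Defs "HOL-Library.Diagonal_Subsequence"
begin

text \<open>
  Fix a dense sequence \<open>d\<close> in the space and let \<open>A\<^sub>m\<close> be the annihilator of its first \<open>m\<close> terms.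
  By weak-star compactness the Kadec--Klee condition becomes uniform: for \<open>h\<close> in a finite set and
  bounded \<open>y \<in> A\<^sub>m\<close> with \<open>m\<close> large, \<open>\<parallel>h + y\<parallel> \<ge> \<parallel>h\<parallel> + c \<parallel>y\<parallel> - \<delta>\<close>. Given \<open>f\<close> of norm at most 1, a pigeonhole
  argument on the distances from \<open>f\<close> to the \<open>A\<^sub>m\<close> yields functionals \<open>g\<^sub>k\<close> that agree with \<open>f\<close> on more and
  more of \<open>d\<close>, are close to finite sets chosen in advance, and satisfy
  \<open>c \<parallel>g\<^sub>k\<^sub>+\<^sub>1 - g\<^sub>k\<parallel> \<le> \<parallel>g\<^sub>k\<^sub>+\<^sub>1\<parallel> - \<parallel>g\<^sub>k\<parallel> + \<eta>\<^sub>k\<close>. Telescoping, \<open>f\<close> is a sum of multiples of members of a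
  fixed weak-star null sequence in the dual unit ball, with coefficients of total size about
  \<open>1 / c \<le> 1 / c\<^sup>2\<close>. Evaluating that sequence embeds the space into \<open>c\<^sub>0\<close> with distortion about \<open>1 / c\<close>.
\<close>

section \<open>Sublinear functionals and the Hahn-Banach theorem\<close>

definition sublinear :: "('a::real_vector \<Rightarrow> real) \<Rightarrow> bool" where
  "sublinear q \<longleftrightarrow> (\<forall>x y. q (x + y) \<le> q x + q y) \<and> (\<forall>a\<ge>0. \<forall>x. q (a *\<^sub>R x) \<le> a * q x)"

lemma sublinear_add: "sublinear q \<Longrightarrow> q (x + y) \<le> q x + q y"
  by (simp add: sublinear_def)

lemma sublinear_zero: "sublinear q \<Longrightarrow> q 0 = 0"
proof -
  assume q: "sublinear q"
  have "q (0 *\<^sub>R 0) \<le> 0 * q 0" using q unfolding sublinear_def by blast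
  moreover have "q (0 + 0) \<le> q 0 + q 0" using q by (rule sublinear_add)
  ultimately show ?thesis by simp
qed

lemma sublinear_minus: "sublinear q \<Longrightarrow> - q (- x) \<le> q x"
  using sublinear_add[of q x "- x"] sublinear_zero[of q] by simp

lemma sublinear_scaleR:
  assumes "sublinear q" "a \<ge> 0"
  shows "q (a *\<^sub>R x) = a * q x"
proof (cases "a = 0")
  case True
  then show ?thesis using sublinear_zero assms by simp
next
  case False
  with assms have a: "a > 0" by simp
  have "q (inverse a *\<^sub>R (a *\<^sub>R x)) \<le> inverse a * q (a *\<^sub>R x)"
    using assms a unfolding sublinear_def by (meson inverse_nonnegative_iff_nonnegative)
  then have "a * q x \<le> q (a *\<^sub>R x)" using a by (simp add: field_simps)
  moreover have "q (a *\<^sub>R x) \<le> a * q x" using assms unfolding sublinear_def by blast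
  ultimately show ?thesis by simp
qed

lemma sublinear_norm: "sublinear (norm :: 'a::real_normed_vector \<Rightarrow> real)"
  by (simp add: sublinear_def norm_triangle_ineq)

text \<open>For sublinear \<open>q\<close> this is the largest sublinear \<open>p\<close> below
  \<open>q\<close> with \<open>p (- y) \<le> - q y\<close>; it is linear on the line spanned by
  \<open>y\<close>.\<close>

definition directional_inf :: "('a::real_vector \<Rightarrow> real) \<Rightarrow> 'a \<Rightarrow> 'a \<Rightarrow> real" where
  "directional_inf q y x = (INF t\<in>{0..}. q (x + t *\<^sub>R y) - t * q y)"

lemma directional_inf_le:
  assumes q: "sublinear q" and "t \<ge> 0"
  shows "directional_inf q y x \<le> q (x + t *\<^sub>R y) - t * q y"
  unfolding directional_inf_def
proof (rule cINF_lower)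
  \<comment> \<open>The real infimum needs a lower bound. Subadditivity for
    \<open>s *\<^sub>R y = (x + s *\<^sub>R y) + (- x)\<close> gives \<open>- q (- x)\<close>,
    independently of \<open>s\<close>.\<close>
  show "bdd_below ((\<lambda>t. q (x + t *\<^sub>R y) - t * q y) ` {0..})"
  proof (rule bdd_belowI2)
    fix s :: real assume "s \<in> {0..}"
    then have "s * q y = q (s *\<^sub>R y)" using sublinear_scaleR[OF q] by simp
    also have "\<dots> \<le> q (x + s *\<^sub>R y) + q (- x)"
      using sublinear_add[OF q, of "x + s *\<^sub>R y" "- x"] by simp
    finally show "- q (- x) \<le> q (x + s *\<^sub>R y) - s * q y" by simp
  qed
qed (use assms in simp)

lemma directional_inf_greatest:
  assumes "\<And>t. t \<ge> 0 \<Longrightarrow> z \<le> q (x + t *\<^sub>R y) - t * q y"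
  shows "z \<le> directional_inf q y x"
  unfolding directional_inf_def using assms by (intro cINF_greatest) auto

text \<open>Parameters add: \<open>s\<close> for one summand and \<open>t\<close> for the other make
  \<open>s + t\<close> admissible for the sum, and the two infima are taken one after the other.
  Scaling the argument by \<open>a\<close> scales the parameter to \<open>a * t\<close>.\<close>

lemma sublinear_directional_inf:
  assumes q: "sublinear q"
  shows "sublinear (directional_inf q y)"
  unfolding sublinear_def
proof (intro conjI allI impI)
  fix x z
  have *: "directional_inf q y (x + z) \<le> (q (x + s *\<^sub>R y) - s * q y) + (q (z + t *\<^sub>R y) - t * q y)"
    if "s \<ge> 0" "t \<ge> 0" for s t
  proof -
    have "directional_inf q y (x + z) \<le> q ((x + z) + (s + t) *\<^sub>R y) - (s + t) * q y"
      using that by (intro directional_inf_le q) simp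
    also have "(x + z) + (s + t) *\<^sub>R y = (x + s *\<^sub>R y) + (z + t *\<^sub>R y)"
      by (simp add: algebra_simps)
    finally show ?thesis
      using sublinear_add[OF q, of "x + s *\<^sub>R y" "z + t *\<^sub>R y"] by (simp add: algebra_simps)
  qed
  have "directional_inf q y (x + z) - (q (x + s *\<^sub>R y) - s * q y) \<le> directional_inf q y z"
    if "s \<ge> 0" for s
    using *[OF that] by (intro directional_inf_greatest) (simp add: algebra_simps)
  then have "directional_inf q y (x + z) - directional_inf q y z \<le> directional_inf q y x"
    by (intro directional_inf_greatest) (simp add: algebra_simps)
  then show "directional_inf q y (x + z) \<le> directional_inf q y x + directional_inf q y z"
    by simp
next
  fix a :: real and x assume a: "0 \<le> a"
  show "directional_inf q y (a *\<^sub>R x) \<le> a * directional_inf q y x"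
  proof (cases "a = 0")
    case True
    then show ?thesis
      using directional_inf_le[OF q, of 0 y 0] sublinear_zero[OF q] by simp
  next
    case False
    with a have a: "a > 0" by simp
    have "directional_inf q y (a *\<^sub>R x) / a \<le> directional_inf q y x"
    proof (rule directional_inf_greatest)
      fix t :: real assume t: "t \<ge> 0"
      have "directional_inf q y (a *\<^sub>R x) \<le> q (a *\<^sub>R x + (a * t) *\<^sub>R y) - (a * t) * q y"
        using a t by (intro directional_inf_le q) simp
      also have "a *\<^sub>R x + (a * t) *\<^sub>R y = a *\<^sub>R (x + t *\<^sub>R y)"
        by (simp add: algebra_simps)
      finally show "directional_inf q y (a *\<^sub>R x) / a \<le> q (x + t *\<^sub>R y) - t * q y"
        using sublinear_scaleR[OF q, of a "x + t *\<^sub>R y"] a by (simp add: field_simps)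
    qed
    then show ?thesis using a by (simp add: field_simps)
  qed
qed

text \<open>Minimality forces \<open>directional_inf q y = q\<close> for every \<open>y\<close>; the
  parameter 1 in the infimum then gives superadditivity.\<close>

lemma minimal_sublinear_is_linear:
  assumes q: "sublinear q" and min: "\<And>p. sublinear p \<Longrightarrow> p \<le> q \<Longrightarrow> p = q"
  shows "linear q"
proof -
  have le: "directional_inf q y \<le> q" for y
    using directional_inf_le[OF q, of 0 y] by (simp add: le_fun_def)
  have "directional_inf q y = q" for y
    by (intro min sublinear_directional_inf q le)
  then have "q x + q y \<le> q (x + y)" for x y
    using directional_inf_le[OF q, of 1 y x] by simp
  then have add: "q (x + y) = q x + q y" for x y
    using sublinear_add[OF q, of x y] by (simp add: antisym)
  then have neg: "q (- x) = - q x" for x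
    using add[of x "- x"] sublinear_zero[OF q] by simp
  have "q (a *\<^sub>R x) = a * q x" for a x
    using sublinear_scaleR[OF q, of a x] sublinear_scaleR[OF q, of "- a" x] neg[of "(-a) *\<^sub>R x"]
    by (cases "a \<ge> 0") auto
  with add show ?thesis by (intro linearI) auto
qed

text \<open>Zorn's lemma for the reversed pointwise order yields a minimal sublinear functional
  below \<open>p\<close>, and minimal ones are linear.\<close>

theorem Hahn_Banach_sublinear:
  assumes p: "sublinear p"
  shows "\<exists>f. linear f \<and> f \<le> p"
proof -
  define S where "S = {q. sublinear q \<and> q \<le> p}"
  have "\<exists>m\<in>S. \<forall>a\<in>S. m \<ge> a \<longrightarrow> a = m"
  proof (rule predicate_Zorn)
    show "partial_order_on S (relation_of (\<lambda>x y. y \<le> x) S)"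
      by (auto simp: partial_order_on_def preorder_on_def refl_on_def trans_def antisym_def
          relation_of_def)
  next
    fix C assume C: "C \<in> Chains (relation_of (\<lambda>x y. y \<le> x) S)"
    show "\<exists>u\<in>S. \<forall>a\<in>C. u \<le> a"
    proof (cases "C = {}")
      case True
      then show ?thesis using p by (auto simp: S_def)
    next
      case False
      have CS: "sublinear q" "q \<le> p" if "q \<in> C" for q
        using C that by (auto simp: Chains_def relation_of_def S_def)
      have tot: "q \<le> r \<or> r \<le> q" if "q \<in> C" "r \<in> C" for q r
        using C that by (auto simp: Chains_def relation_of_def)
      \<comment> \<open>The pointwise infimum bounds the chain. Totality makes it subadditive: the
        smaller of two members handles both summands at once.\<close>
      define u where "u x = (INF q\<in>C. q x)" for x
      have lower: "u x \<le> q x" if "q \<in> C" for q x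
        unfolding u_def
      proof (rule cINF_lower[OF _ that], rule bdd_belowI2)
        fix r assume r: "r \<in> C"
        show "- p (- x) \<le> r x"
          using sublinear_minus[OF CS(1)[OF r], of x] CS(2)[OF r]
          by (smt (verit) le_funD)
      qed
      have greatest: "z \<le> u x" if "\<And>q. q \<in> C \<Longrightarrow> z \<le> q x" for z x
        unfolding u_def using False that by (intro cINF_greatest) auto
      have "u (x + y) \<le> u x + u y" for x y
      proof -
        have *: "u (x + y) \<le> q x + r y" if qr: "q \<in> C" "r \<in> C" for q r
        proof -
          obtain s where "s \<in> C" "s \<le> q" "s \<le> r"
            using tot[OF qr] qr by (metis order_refl)
          then show ?thesis
            using lower[of s "x + y"] sublinear_add[OF CS(1), of s x y]
            by (smt (verit) le_funD)
        qed
        have "u (x + y) - q x \<le> u y" if "q \<in> C" for q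
          using *[OF that] by (intro greatest) (simp add: algebra_simps)
        then have "u (x + y) - u y \<le> u x"
          by (intro greatest) (simp add: algebra_simps)
        then show ?thesis by simp
      qed
      moreover have "u (a *\<^sub>R x) \<le> a * u x" if a: "a \<ge> 0" for a x
      proof (cases "a = 0")
        case True
        then show ?thesis using False lower[of _ 0] sublinear_zero CS by fastforce
      next
        case False
        with a have a: "a > 0" by simp
        have "u (a *\<^sub>R x) / a \<le> u x"
        proof (rule greatest)
          fix q assume "q \<in> C"
          then show "u (a *\<^sub>R x) / a \<le> q x"
            using lower[of q "a *\<^sub>R x"] sublinear_scaleR[OF CS(1), of q a x] a
            by (simp add: field_simps)
        qed
        then show ?thesis using a by (simp add: field_simps)
      qed
      ultimately have "sublinear u" by (simp add: sublinear_def)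
      moreover have "u \<le> p"
        using False lower CS(2) by (metis all_not_in_conv le_fun_def order_trans)
      ultimately show ?thesis
        using lower by (auto simp: S_def le_fun_def)
    qed
  qed
  then obtain m where "sublinear m" "m \<le> p" "\<And>a. sublinear a \<Longrightarrow> a \<le> m \<Longrightarrow> a = m"
    by (force simp: S_def intro: order_trans)
  then show ?thesis using minimal_sublinear_is_linear by blast
qed

text \<open>Hahn-Banach is applied to \<open>directional_inf norm x\<close> instead of the norm. The
  result still lies below the norm, and its value at \<open>- x\<close> is at most
  \<open>- norm x\<close>, so it attains \<open>norm x\<close> at \<open>x\<close>.\<close>

lemma norming_functional:
  fixes x :: "'a::real_normed_vector"
  shows "\<exists>f :: 'a \<Rightarrow>\<^sub>L real. norm f \<le> 1 \<and> blinfun_apply f x = norm x"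
proof -
  obtain f where f: "linear f" "f \<le> directional_inf norm x"
    using Hahn_Banach_sublinear[OF sublinear_directional_inf[OF sublinear_norm]] by blast
  have le: "f y \<le> norm y" for y
    using f(2) directional_inf_le[OF sublinear_norm, of 0 x y]
    by (smt (verit) le_funD add_0_right scale_zero_left mult_zero_left)
  have abs: "\<bar>f y\<bar> \<le> norm y" for y
    using le[of y] le[of "- y"] linear_neg[OF f(1), of y] by simp
  have "f (- x) \<le> norm (- x + 1 *\<^sub>R x) - 1 * norm x"
    using f(2) directional_inf_le[OF sublinear_norm, of 1 x "- x"]
    by (smt (verit) le_funD)
  then have fx: "f x = norm x"
    using le[of x] linear_neg[OF f(1), of x] by simp
  have bl: "bounded_linear f"
    using f(1) abs by (intro bounded_linear_intro[where K = 1]) (auto simp: linear_add linear_scale)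
  have "norm (Blinfun f) \<le> 1"
    using abs by (intro norm_blinfun_bound) (auto simp: bounded_linear_Blinfun_apply[OF bl])
  then show ?thesis
    using fx by (intro exI[of _ "Blinfun f"]) (simp add: bounded_linear_Blinfun_apply[OF bl])
qed

section \<open>Weak-star null sequences and sequential weak-star compactness\<close>

lemma weak_star_nullI_dense:
  fixes y :: "nat \<Rightarrow> 'a::real_normed_vector \<Rightarrow>\<^sub>L real"
  assumes dense: "closure (range d) = UNIV" and bound: "\<And>n. norm (y n) \<le> R"
    and null: "\<And>j::nat. (\<lambda>n. blinfun_apply (y n) (d j)) \<longlonglongrightarrow> 0"
  shows "weak_star_null y"
  unfolding weak_star_null_def
proof (intro allI LIMSEQ_I)
  fix x :: 'a and e :: real assume e: "0 < e"
  have R: "0 \<le> R" using bound[of 0] norm_ge_zero order_trans by blast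
  have "x \<in> closure (range d)" by (simp add: dense)
  moreover have "e / (2 * (R + 1)) > 0" using e R by simp
  ultimately obtain j where j: "dist (d j) x < e / (2 * (R + 1))"
    unfolding closure_approachable by (metis rangeE)
  obtain N where N: "\<And>n. n \<ge> N \<Longrightarrow> \<bar>blinfun_apply (y n) (d j)\<bar> < e / 2"
    using LIMSEQ_D[OF null[of j], of "e / 2"] e by auto
  have "\<bar>blinfun_apply (y n) x\<bar> < e" if "n \<ge> N" for n
  proof -
    have "\<bar>blinfun_apply (y n) (x - d j)\<bar> \<le> norm (y n) * norm (x - d j)"
      using norm_blinfun[of "y n" "x - d j"] by simp
    also have "\<dots> \<le> (R + 1) * (e / (2 * (R + 1)))"
      using j bound[of n] R by (intro mult_mono) (auto simp: dist_norm norm_minus_commute)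
    also have "\<dots> = e / 2" using R by (simp add: divide_simps)
    finally have "\<bar>blinfun_apply (y n) x - blinfun_apply (y n) (d j)\<bar> \<le> e / 2"
      by (simp add: blinfun.diff_right)
    then show ?thesis using N[OF that] by linarith
  qed
  then show "\<exists>N. \<forall>n\<ge>N. norm (blinfun_apply (y n) x - 0) < e" by auto
qed

lemma weak_star_null_subseq:
  assumes "weak_star_null y" "strict_mono r"
  shows "weak_star_null (\<lambda>n. y (r n))"
  unfolding weak_star_null_def
proof
  fix x
  show "(\<lambda>n. blinfun_apply (y (r n)) x) \<longlonglongrightarrow> 0"
    using LIMSEQ_subseq_LIMSEQ[of "\<lambda>n. blinfun_apply (y n) x" 0 r] assms
    by (simp add: o_def weak_star_null_def)
qed

text \<open>A diagonal subsequence converges at every \<open>d k\<close>. The uniform bound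
  \<open>R\<close> and density carry convergence over to every point, and the pointwise limit is
  again bounded and linear.\<close>

lemma sequential_Banach_Alaoglu:
  fixes h :: "nat \<Rightarrow> 'a::real_normed_vector \<Rightarrow>\<^sub>L real"
  assumes dense: "closure (range (d::nat \<Rightarrow> 'a)) = UNIV" and bound: "\<And>n. norm (h n) \<le> R"
  obtains r g where "strict_mono r" "weak_star_null (\<lambda>n. h (r n) - g)"
proof -
  have R: "0 \<le> R" using bound[of 0] norm_ge_zero order_trans by blast
  have bd: "\<bar>blinfun_apply (h n) x\<bar> \<le> R * norm x" for n x
    using norm_blinfun[of "h n" x] mult_right_mono[OF bound[of n] norm_ge_zero[of x]] by simp
  interpret subseqs "\<lambda>n s. convergent (\<lambda>i. blinfun_apply (h (s i)) (d n))"
  proof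
    fix n and s :: "nat \<Rightarrow> nat"
    have "bounded (range (\<lambda>i. blinfun_apply (h (s i)) (d n)))"
      using bd by (intro boundedI[where B = "R * norm (d n)"]) auto
    then show "\<exists>r'. strict_mono r' \<and> convergent (\<lambda>i. blinfun_apply (h ((s \<circ> r') i)) (d n))"
      using bounded_imp_convergent_subsequence unfolding convergent_def o_def by blast
  qed
  define r where "r = diagseq"
  have r: "strict_mono r" unfolding r_def by (rule subseq_diagseq)
  have conv_d: "convergent (\<lambda>i. blinfun_apply (h (r i)) (d k))" for k
  proof -
    \<comment> \<open>The diagonal sequence is a subsequence of the stage that handles
      \<open>d k\<close> only from index \<open>Suc k\<close> on; the initial segment is discarded
      afterwards.\<close>
    have "convergent (\<lambda>i. blinfun_apply (h ((diagseq \<circ> ((+) (Suc k))) i)) (d k))"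
    proof (rule diagseq_holds)
      fix r s :: "nat \<Rightarrow> nat" and n
      assume "strict_mono r" "convergent (\<lambda>i. blinfun_apply (h (s i)) (d n))"
      then show "convergent (\<lambda>i. blinfun_apply (h ((s \<circ> r) i)) (d n))"
        using convergent_subseq_convergent[of "\<lambda>i. blinfun_apply (h (s i)) (d n)" r]
        by (simp add: o_def)
    qed
    then have "convergent (\<lambda>i. blinfun_apply (h (r (i + Suc k))) (d k))"
      by (simp add: o_def r_def add.commute)
    then show ?thesis
      using convergent_ignore_initial_segment[of "\<lambda>i. blinfun_apply (h (r i)) (d k)" "Suc k"]
      by (simp add: o_def)
  qed
  have conv: "convergent (\<lambda>i. blinfun_apply (h (r i)) x)" for x
  proof -
    have "Cauchy (\<lambda>i. blinfun_apply (h (r i)) x)"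
    proof (rule metric_CauchyI)
      fix e :: real assume e: "e > 0"
      have "x \<in> closure (range d)" by (simp add: dense)
      moreover have "e / (4 * (R + 1)) > 0" using e R by simp
      ultimately obtain j where j: "dist (d j) x < e / (4 * (R + 1))"
        unfolding closure_approachable by (metis rangeE)
      have near: "\<bar>blinfun_apply (h n) x - blinfun_apply (h n) (d j)\<bar> \<le> e / 4" for n
      proof -
        have "\<bar>blinfun_apply (h n) (x - d j)\<bar> \<le> R * norm (x - d j)" by (rule bd)
        also have "\<dots> \<le> (R + 1) * (e / (4 * (R + 1)))"
          using j R by (intro mult_mono) (auto simp: dist_norm norm_minus_commute)
        also have "\<dots> = e / 4" using R by (simp add: divide_simps)
        finally show ?thesis by (simp add: blinfun.diff_right)
      qed
      obtain N where N: "\<And>m n. m \<ge> N \<Longrightarrow> n \<ge> N \<Longrightarrow>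
          dist (blinfun_apply (h (r m)) (d j)) (blinfun_apply (h (r n)) (d j)) < e / 2"
        using metric_CauchyD[OF convergent_Cauchy[OF conv_d[of j]], of "e / 2"] e by auto
      have "dist (blinfun_apply (h (r m)) x) (blinfun_apply (h (r n)) x) < e"
        if "m \<ge> N" "n \<ge> N" for m n
        using N[OF that] near[of "r m"] near[of "r n"] unfolding dist_real_def by linarith
      then show "\<exists>M. \<forall>m\<ge>M. \<forall>n\<ge>M.
          dist (blinfun_apply (h (r m)) x) (blinfun_apply (h (r n)) x) < e" by blast
    qed
    then show ?thesis by (rule Cauchy_convergent)
  qed
  define L where "L x = lim (\<lambda>i. blinfun_apply (h (r i)) x)" for x
  have L: "(\<lambda>i. blinfun_apply (h (r i)) x) \<longlonglongrightarrow> L x" for x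
    unfolding L_def using conv[of x] by (simp add: convergent_LIMSEQ_iff)
  have "bounded_linear L"
  proof (rule bounded_linear_intro[where K = R])
    show "L (x + y) = L x + L y" for x y
      using LIMSEQ_unique[OF L[of "x + y"]] tendsto_add[OF L[of x] L[of y]]
      by (simp add: blinfun.add_right)
    show "L (a *\<^sub>R x) = a *\<^sub>R L x" for a x
      using LIMSEQ_unique[OF L[of "a *\<^sub>R x"]] tendsto_scaleR[OF tendsto_const L[of x], of a]
      by (simp add: blinfun.scaleR_right)
    show "norm (L x) \<le> norm x * R" for x
      using Lim_bounded[OF tendsto_rabs[OF L[of x]], of 0 "R * norm x"] bd[of _ x]
      by (simp add: mult.commute)
  qed
  then have "weak_star_null (\<lambda>n. h (r n) - Blinfun L)"
    unfolding weak_star_null_def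
    using LIM_zero[OF L] by (simp add: blinfun.diff_left bounded_linear_Blinfun_apply)
  with r show ?thesis by (rule that)
qed

text \<open>Convergence of the norms of \<open>z n\<close> and of the dominating sequence
  \<open>b\<close> turns the limsup condition into an inequality of real numbers. The compactness
  arguments reach this situation by passing to subsequences.\<close>

lemma LKK_star_limit:
  fixes f :: "'a::real_normed_vector \<Rightarrow>\<^sub>L real"
  assumes LKK: "c_LKK_star c TYPE('a)" and "weak_star_null z"
    and l: "(\<lambda>n. norm (z n)) \<longlonglongrightarrow> l"
    and le: "\<And>n. norm (f + z n) \<le> b n" and b: "b \<longlonglongrightarrow> B"
  shows "norm f + c * l \<le> B"
proof -
  have "limsup (\<lambda>n. ereal (norm (z n))) = ereal l"
    using l by (intro lim_imp_Limsup) auto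
  moreover have "limsup (\<lambda>n. ereal (b n)) = ereal B"
    using b by (intro lim_imp_Limsup) auto
  moreover have "limsup (\<lambda>n. ereal (norm (f + z n))) \<le> limsup (\<lambda>n. ereal (b n))"
    using le by (intro Limsup_mono) auto
  moreover have "ereal (norm f) + ereal c * limsup (\<lambda>n. ereal (norm (z n)))
      \<le> limsup (\<lambda>n. ereal (norm (f + z n)))"
    using LKK \<open>weak_star_null z\<close> unfolding c_LKK_star_def by blast
  ultimately have "ereal (norm f) + ereal c * ereal l \<le> ereal B"
    by (metis order_trans)
  then show ?thesis by simp
qed

section \<open>Annihilators of initial segments of a sequence, and the distances to them\<close>

text \<open>The distance from \<open>f\<close> to this subspace is the quotient norm of
  \<open>f\<close>, that is, the norm of its restriction to the span of the first \<open>m\<close>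
  terms of \<open>d\<close>.\<close>

definition annihilator :: "(nat \<Rightarrow> 'a::real_normed_vector) \<Rightarrow> nat \<Rightarrow> ('a \<Rightarrow>\<^sub>L real) set" where
  "annihilator d m = {f. \<forall>j<m. blinfun_apply f (d j) = 0}"

lemma annihilator_zero [simp]: "0 \<in> annihilator d m"
  by (simp add: annihilator_def)

lemma annihilator_add: "f \<in> annihilator d m \<Longrightarrow> g \<in> annihilator d m \<Longrightarrow> f + g \<in> annihilator d m"
  by (simp add: annihilator_def blinfun.add_left)

lemma annihilator_diff: "f \<in> annihilator d m \<Longrightarrow> g \<in> annihilator d m \<Longrightarrow> f - g \<in> annihilator d m"
  by (simp add: annihilator_def blinfun.diff_left)

lemma annihilator_antimono: "m \<le> n \<Longrightarrow> annihilator d n \<subseteq> annihilator d m"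
  by (auto simp: annihilator_def)

lemma infdist_annihilator_le_norm: "infdist f (annihilator d m) \<le> norm f"
  using infdist_le[OF annihilator_zero, of f d m] by simp

text \<open>The annihilator is a subspace, so it is invariant under translation by \<open>v\<close>.
  One inequality suffices: it is used for \<open>v\<close> and then for its negative
  \<open>0 - v\<close>.\<close>

lemma infdist_annihilator_diff:
  assumes "v \<in> annihilator d m"
  shows "infdist (f - v) (annihilator d m) = infdist f (annihilator d m)"
proof -
  have "infdist g (annihilator d m) \<le> infdist (g - w) (annihilator d m)"
    if w: "w \<in> annihilator d m" for g w
  proof -
    have "infdist g (annihilator d m) \<le> dist (g - w) a" if "a \<in> annihilator d m" for a
      using infdist_le[OF annihilator_add[OF that w], of g] by (simp add: dist_norm algebra_simps)
    moreover have "annihilator d m \<noteq> {}" using annihilator_zero by blast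
    ultimately show ?thesis
      unfolding infdist_notempty[OF \<open>annihilator d m \<noteq> {}\<close>, of "g - w"]
      by (intro cINF_greatest) auto
  qed
  from this[of v f] this[of "0 - v" "f - v"] assms annihilator_diff[OF annihilator_zero assms]
  show ?thesis by simp
qed

lemma infdist_annihilator_attained:
  assumes "e > 0"
  obtains v where "v \<in> annihilator d m" "norm (f - v) < infdist f (annihilator d m) + e"
proof -
  have ne: "annihilator d m \<noteq> {}" using annihilator_zero by blast
  have "(INF a\<in>annihilator d m. dist f a) < infdist f (annihilator d m) + e"
    using infdist_notempty[OF ne] assms by (metis less_add_same_cancel1)
  then show ?thesis
    using cINF_less_iff[OF ne bdd_belowI2[of _ 0 "dist f"]] that
    by (auto simp: dist_norm)
qed

text \<open>The quotient of the dual by an annihilator is finite dimensional, so its norm is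
  controlled by finitely many evaluations.\<close>

lemma infdist_annihilator_le_sum:
  "\<exists>C. \<forall>f. infdist f (annihilator d m) \<le> C * (\<Sum>j<m. \<bar>blinfun_apply f (d j)\<bar>)"
proof -
  \<comment> \<open>The induction carries an actual approximant \<open>y\<close>, which can be
    corrected at the next term, and the sign of \<open>C\<close>, which keeps the bound monotone in
    the sum.\<close>
  have "\<exists>C\<ge>0. \<forall>f. \<exists>y\<in>annihilator d m. norm (f - y) \<le> C * (\<Sum>j<m. \<bar>blinfun_apply f (d j)\<bar>)"
  proof (induction m)
    case 0
    have "\<exists>y\<in>annihilator d 0. norm (f - y) \<le> 0 * (\<Sum>j<0. \<bar>blinfun_apply f (d j)\<bar>)" for f
      by (rule bexI[of _ f]) (simp_all add: annihilator_def)
    then show ?case by blast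
  next
    case (Suc m)
    then obtain C where C: "C \<ge> 0"
      "\<And>f. \<exists>y\<in>annihilator d m. norm (f - y) \<le> C * (\<Sum>j<m. \<bar>blinfun_apply f (d j)\<bar>)" by blast
    show ?case
    proof (cases "\<exists>u\<in>annihilator d m. blinfun_apply u (d m) \<noteq> 0")
      case False
      then have "annihilator d m \<subseteq> annihilator d (Suc m)"
        by (auto simp: annihilator_def less_Suc_eq)
      moreover have "C * (\<Sum>j<m. \<bar>blinfun_apply f (d j)\<bar>) \<le> C * (\<Sum>j<Suc m. \<bar>blinfun_apply f (d j)\<bar>)"
        for f using C(1) by (intro mult_left_mono) auto
      ultimately have "\<exists>y\<in>annihilator d (Suc m).
          norm (f - y) \<le> C * (\<Sum>j<Suc m. \<bar>blinfun_apply f (d j)\<bar>)" for f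
        using C(2)[of f] order_trans by blast
      with C(1) show ?thesis by blast
    next
      case True
      then obtain u0 where u0: "u0 \<in> annihilator d m" "blinfun_apply u0 (d m) \<noteq> 0" by blast
      \<comment> \<open>Normalised to value 1 at \<open>d m\<close> and vanishing at the earlier
        terms, \<open>u\<close> removes the value of \<open>y\<close> at \<open>d m\<close> without
        disturbing the others.\<close>
      define u where "u = inverse (blinfun_apply u0 (d m)) *\<^sub>R u0"
      have u: "blinfun_apply u (d j) = 0" if "j < m" for j
        using u0(1) that by (simp add: u_def annihilator_def blinfun.scaleR_left)
      have um: "blinfun_apply u (d m) = 1"
        using u0(2) by (simp add: u_def blinfun.scaleR_left)
      \<comment> \<open>The correction costs \<open>\<bar>y (d m)\<bar> * norm u\<close>, and
        \<open>\<bar>y (d m)\<bar>\<close> is at most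
        \<open>\<bar>f (d m)\<bar> + norm (f - y) * norm (d m)\<close>, hence at most
        \<open>(1 + C * norm (d m)) * s\<close>.\<close>
      define C' where "C' = C + norm u * (1 + C * norm (d m))"
      have "\<exists>y\<in>annihilator d (Suc m). norm (f - y) \<le> C' * (\<Sum>j<Suc m. \<bar>blinfun_apply f (d j)\<bar>)" for f
      proof -
        obtain y where y: "y \<in> annihilator d m" "norm (f - y) \<le> C * (\<Sum>j<m. \<bar>blinfun_apply f (d j)\<bar>)"
          using C(2) by blast
        define s where "s = (\<Sum>j<Suc m. \<bar>blinfun_apply f (d j)\<bar>)"
        have s: "\<bar>blinfun_apply f (d m)\<bar> \<le> s" "(\<Sum>j<m. \<bar>blinfun_apply f (d j)\<bar>) \<le> s" "0 \<le> s"
          by (auto simp: s_def sum_nonneg)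
        have fy: "norm (f - y) \<le> C * s" using y(2) s(2) C(1) by (meson mult_left_mono order_trans)
        define y' where "y' = y - blinfun_apply y (d m) *\<^sub>R u"
        have "y' \<in> annihilator d (Suc m)"
          using y(1) u um
          by (auto simp: y'_def annihilator_def less_Suc_eq blinfun.diff_left blinfun.scaleR_left)
        moreover have "norm (f - y') \<le> C' * s"
        proof -
          have "\<bar>blinfun_apply (f - y) (d m)\<bar> \<le> (C * s) * norm (d m)"
            using norm_blinfun[of "f - y" "d m"] mult_right_mono[OF fy norm_ge_zero[of "d m"]] by simp
          then have "\<bar>blinfun_apply y (d m)\<bar> \<le> s + (C * s) * norm (d m)"
            using s(1) by (simp add: blinfun.diff_left)
          then have "\<bar>blinfun_apply y (d m)\<bar> * norm u \<le> (s + (C * s) * norm (d m)) * norm u"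
            by (rule mult_right_mono) simp
          moreover have "norm (f - y') \<le> norm (f - y) + \<bar>blinfun_apply y (d m)\<bar> * norm u"
            using norm_triangle_ineq[of "f - y" "blinfun_apply y (d m) *\<^sub>R u"]
            by (simp add: y'_def algebra_simps)
          ultimately show ?thesis using fy by (simp add: C'_def algebra_simps)
        qed
        ultimately show ?thesis unfolding s_def by blast
      qed
      moreover have "C' \<ge> 0" using C(1) by (simp add: C'_def)
      ultimately show ?thesis by blast
    qed
  qed
  then obtain C where C: "\<And>f. \<exists>y\<in>annihilator d m. norm (f - y) \<le> C * (\<Sum>j<m. \<bar>blinfun_apply f (d j)\<bar>)"
    by blast
  have "infdist f (annihilator d m) \<le> C * (\<Sum>j<m. \<bar>blinfun_apply f (d j)\<bar>)" for f
    using C[of f] by (auto simp: dist_norm intro: infdist_le2)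
  then show ?thesis by blast
qed

lemma infdist_annihilator_weak_star_null:
  assumes "weak_star_null z"
  shows "(\<lambda>n. infdist (z n) (annihilator d m)) \<longlonglongrightarrow> 0"
proof -
  obtain C where C: "\<And>f. infdist f (annihilator d m) \<le> C * (\<Sum>j<m. \<bar>blinfun_apply f (d j)\<bar>)"
    using infdist_annihilator_le_sum by blast
  have "(\<lambda>n. C * (\<Sum>j<m. \<bar>blinfun_apply (z n) (d j)\<bar>)) \<longlonglongrightarrow> C * (\<Sum>j<m. \<bar>0\<bar>)"
    using assms by (intro tendsto_intros) (auto simp: weak_star_null_def)
  then have lim: "(\<lambda>n. C * (\<Sum>j<m. \<bar>blinfun_apply (z n) (d j)\<bar>)) \<longlonglongrightarrow> 0" by simp
  show ?thesis
    by (rule tendsto_sandwich[OF always_eventually always_eventually tendsto_const lim])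
      (simp_all add: C infdist_nonneg)
qed

section \<open>Uniform forms of the Kadec-Klee condition\<close>

text \<open>Counterexamples \<open>y m\<close> for all \<open>m\<close> would form a bounded
  sequence that eventually vanishes at each \<open>d j\<close>, hence a weak-star null one. Along a
  subsequence with convergent norms it violates the Kadec-Klee inequality by
  \<open>\<delta>\<close>.\<close>

lemma LKK_star_lower_estimate:
  fixes d :: "nat \<Rightarrow> 'a::real_normed_vector"
  assumes LKK: "c_LKK_star c TYPE('a)" and dense: "closure (range d) = UNIV" and "\<delta> > 0"
  shows "\<exists>m. \<forall>y\<in>annihilator d m. norm y \<le> R \<longrightarrow> norm h + c * norm y - \<delta> \<le> norm (h + y)"
proof (rule ccontr)
  assume "\<not> ?thesis"
  then have "\<forall>m. \<exists>y\<in>annihilator d m. norm y \<le> R \<and> norm (h + y) < norm h + c * norm y - \<delta>"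
    by (meson not_le)
  then obtain y where y: "\<And>m. y m \<in> annihilator d m" "\<And>m. norm (y m) \<le> R"
    "\<And>m. norm (h + y m) < norm h + c * norm (y m) - \<delta>" by metis
  have null: "weak_star_null y"
  proof (rule weak_star_nullI_dense[OF dense y(2)])
    fix j
    have "eventually (\<lambda>m. blinfun_apply (y m) (d j) = 0) sequentially"
      using y(1) by (intro eventually_sequentiallyI[of "Suc j"]) (auto simp: annihilator_def)
    then show "(\<lambda>m. blinfun_apply (y m) (d j)) \<longlonglongrightarrow> 0" by (rule tendsto_eventually)
  qed
  have "bounded (range (\<lambda>m. norm (y m)))" using y(2) by (intro boundedI[where B = R]) auto
  then obtain l r where r: "strict_mono (r::nat \<Rightarrow> nat)" and l: "(\<lambda>n. norm (y (r n))) \<longlonglongrightarrow> l"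
    using bounded_imp_convergent_subsequence unfolding o_def by blast
  have "norm h + c * l \<le> norm h + c * l - \<delta>"
  proof (rule LKK_star_limit[OF LKK weak_star_null_subseq[OF null r] l])
    show "norm (h + y (r n)) \<le> norm h + c * norm (y (r n)) - \<delta>" for n
      using y(3)[of "r n"] by simp
    show "(\<lambda>n. norm h + c * norm (y (r n)) - \<delta>) \<longlonglongrightarrow> norm h + c * l - \<delta>"
      by (intro tendsto_intros l)
  qed
  with \<open>\<delta> > 0\<close> show False by simp
qed

text \<open>Functionals whose norm is almost attained on a fixed finite-dimensional subspace of the
  predual form an almost totally bounded set: the Kadec--Klee estimate bounds the
  oscillation of any weak-star convergent sequence of them.\<close>

lemma LKK_star_finite_net:
  fixes d :: "nat \<Rightarrow> 'a::real_normed_vector"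
  assumes LKK: "c_LKK_star c TYPE('a)" and dense: "closure (range d) = UNIV"
    and "c > 0" "\<eta> > 0"
  shows "\<exists>H. finite H \<and> (\<forall>h. norm h \<le> R \<longrightarrow> norm h \<le> infdist h (annihilator d m) + \<eta> \<longrightarrow>
           (\<exists>k\<in>H. norm (h - k) \<le> 3 * \<eta> / c))"
proof (rule ccontr)
  assume no: "\<not> ?thesis"
  define S where "S = {h. norm h \<le> R \<and> norm h \<le> infdist h (annihilator d m) + \<eta>}"
  have no': "\<exists>h\<in>S. \<forall>k\<in>K. norm (h - k) > 3 * \<eta> / c" if "finite K" for K
  proof (rule ccontr)
    assume "\<not> ?thesis"
    then have "\<forall>h\<in>S. \<exists>k\<in>K. norm (h - k) \<le> 3 * \<eta> / c" by (simp add: not_less)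
    then show False using no[unfolded not_ex, THEN spec, of K] that by (simp add: S_def)
  qed
  \<comment> \<open>Without a finite net, each new point can be chosen at distance more than
    \<open>3 * \<eta> / c\<close> from all earlier ones; a weak-star convergent subsequence will
    contradict this separation.\<close>
  let ?Q = "\<lambda>x n r. r \<in> S \<and> (\<forall>i<(n::nat). norm (r - x i) > 3 * \<eta> / c)"
  have "\<exists>x. \<forall>n::nat. ?Q x n (x n)"
  proof (rule dependent_wellorder_choice)
    fix n :: nat and x :: "nat \<Rightarrow> 'a \<Rightarrow>\<^sub>L real"
    show "\<exists>r. ?Q x n r" using no'[of "x ` {..<n}"] by auto
  qed simp
  then obtain x :: "nat \<Rightarrow> 'a \<Rightarrow>\<^sub>L real" where xS: "\<And>n. x n \<in> S"
    and sep: "\<And>i n. i < n \<Longrightarrow> norm (x n - x i) > 3 * \<eta> / c"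
    by blast
  have xR: "norm (x n) \<le> R" for n using xS[of n] by (simp add: S_def)
  obtain r g where r: "strict_mono r" and null: "weak_star_null (\<lambda>n. x (r n) - g)"
    by (rule sequential_Banach_Alaoglu[OF dense xR])
  have "norm (x (r n) - g) \<le> R + norm g" for n
    using norm_triangle_ineq4[of "x (r n)" g] xR[of "r n"] by linarith
  then have "bounded (range (\<lambda>n. norm (x (r n) - g)))"
    by (intro boundedI[where B = "R + norm g"]) auto
  then obtain l s where s: "strict_mono (s::nat \<Rightarrow> nat)"
    and l: "(\<lambda>n. norm (x (r (s n)) - g)) \<longlonglongrightarrow> l"
    using bounded_imp_convergent_subsequence unfolding o_def by blast
  define z where "z n = x (r (s n)) - g" for n
  have z: "weak_star_null z" unfolding z_def using weak_star_null_subseq[OF null s] .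
  \<comment> \<open>The distance to the annihilator changes by at most \<open>norm g\<close> when
    \<open>g\<close> is removed, and the distance of the weak-star null \<open>z n\<close> tends to
    0. Hence \<open>c * l \<le> \<eta>\<close>.\<close>
  have "norm g + c * l \<le> norm g + 0 + \<eta>"
  proof (rule LKK_star_limit[OF LKK z])
    show "(\<lambda>n. norm (z n)) \<longlonglongrightarrow> l" unfolding z_def by (rule l)
    show "(\<lambda>n. norm g + infdist (z n) (annihilator d m) + \<eta>) \<longlonglongrightarrow> norm g + 0 + \<eta>"
      by (intro tendsto_intros infdist_annihilator_weak_star_null z)
    show "norm (g + z n) \<le> norm g + infdist (z n) (annihilator d m) + \<eta>" for n
    proof -
      have "norm (g + z n) \<le> infdist (g + z n) (annihilator d m) + \<eta>"
        using xS[of "r (s n)"] by (simp add: S_def z_def)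
      also have "infdist (g + z n) (annihilator d m) \<le> infdist (z n) (annihilator d m) + norm g"
        using infdist_triangle[of "g + z n" _ "z n"] by (simp add: dist_norm)
      finally show ?thesis by simp
    qed
  qed
  then have "l \<le> \<eta> / c" using \<open>c > 0\<close> by (simp add: field_simps)
  \<comment> \<open>Two late terms are both this close to \<open>g\<close>, so their mutual distance
    is below \<open>3 * \<eta> / c\<close>; any factor above 2 in place of 3 would leave such
    room.\<close>
  also have "\<dots> < 3 * \<eta> / (2 * c)" using \<open>c > 0\<close> \<open>\<eta> > 0\<close> by (simp add: field_simps)
  finally have "eventually (\<lambda>n. norm (z n) < 3 * \<eta> / (2 * c)) sequentially"
    using l unfolding z_def by (rule order_tendstoD(2)[rotated])
  then obtain N where N: "\<And>n. n \<ge> N \<Longrightarrow> norm (z n) < 3 * \<eta> / (2 * c)"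
    by (auto simp: eventually_sequentially)
  have "norm (z (Suc N) - z N) < 3 * \<eta> / c"
    using norm_triangle_ineq4[of "z (Suc N)" "z N"] N[of N] N[of "Suc N"] by (simp add: field_simps)
  moreover have "r (s N) < r (s (Suc N))" using r s by (simp add: strict_mono_def)
  ultimately show False using sep[of "r (s N)" "r (s (Suc N))"] by (simp add: z_def)
qed

text \<open>The index in the lower estimate depends on the functional, so it is maximised over the
  finite net \<open>H\<close>. Passing from \<open>h\<close> to its centre and back costs
  \<open>3 * \<eta> / c\<close> twice, whence \<open>1 + 6 / c\<close>. The bound 4 covers
  differences of two functionals of norm at most 2.\<close>

lemma LKK_star_gap:
  fixes d :: "nat \<Rightarrow> 'a::real_normed_vector"
  assumes LKK: "c_LKK_star c TYPE('a)" and dense: "closure (range d) = UNIV"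
    and "c > 0" "\<eta> > 0"
  shows "\<exists>m' H. m < m' \<and> finite H \<and>
    (\<forall>h. norm h \<le> 2 \<longrightarrow> norm h \<le> infdist h (annihilator d m) + \<eta> \<longrightarrow>
       (\<exists>k\<in>H. norm (h - k) \<le> 3 * \<eta> / c) \<and>
       (\<forall>y\<in>annihilator d m'. norm y \<le> 4 \<longrightarrow>
          norm h + c * norm y - (1 + 6 / c) * \<eta> \<le> norm (h + y)))"
proof -
  obtain H where "finite H" and
    H: "\<And>h. norm h \<le> 2 \<Longrightarrow> norm h \<le> infdist h (annihilator d m) + \<eta> \<Longrightarrow>
         \<exists>k\<in>H. norm (h - k) \<le> 3 * \<eta> / c"
    using LKK_star_finite_net[OF assms, of 2 m] by blast
  have "\<forall>h. \<exists>i. \<forall>y\<in>annihilator d i. norm y \<le> 4 \<longrightarrow> norm h + c * norm y - \<eta> \<le> norm (h + y)"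
    using LKK_star_lower_estimate[OF LKK dense \<open>\<eta> > 0\<close>] by blast
  then obtain p where
    p: "\<And>h y. y \<in> annihilator d (p h) \<Longrightarrow> norm y \<le> 4 \<Longrightarrow> norm h + c * norm y - \<eta> \<le> norm (h + y)"
    by metis
  define m' where "m' = Max (insert (Suc m) (p ` H))"
  have "m < m'" unfolding m'_def using \<open>finite H\<close>
    by (metis Max_ge finite_imageI finite_insert insertI1 Suc_le_lessD)
  have pm': "p k \<le> m'" if "k \<in> H" for k
    unfolding m'_def using \<open>finite H\<close> that by (intro Max_ge) auto
  have "norm h + c * norm y - (1 + 6 / c) * \<eta> \<le> norm (h + y)"
    if h: "norm h \<le> 2" "norm h \<le> infdist h (annihilator d m) + \<eta>"
      and y: "y \<in> annihilator d m'" "norm y \<le> 4" for h y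
  proof -
    obtain k where k: "k \<in> H" "norm (h - k) \<le> 3 * \<eta> / c" using H[OF h] by blast
    have "y \<in> annihilator d (p k)" using y(1) annihilator_antimono[OF pm'[OF k(1)]] by blast
    then have "norm k + c * norm y - \<eta> \<le> norm (k + y)" using p y(2) by blast
    moreover have "norm h \<le> norm k + norm (h - k)" by (metis norm_triangle_sub add.commute)
    moreover have "norm (k + y) \<le> norm (h + y) + norm (h - k)"
      using norm_triangle_ineq4[of "h + y" "h - k"] by (simp add: algebra_simps)
    ultimately have "norm h + c * norm y - (\<eta> + 2 * (3 * \<eta> / c)) \<le> norm (h + y)"
      using k(2) by linarith
    moreover have "(1 + 6 / c) * \<eta> = \<eta> + 2 * (3 * \<eta> / c)"
      using \<open>c > 0\<close> by (simp add: field_simps)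
    ultimately show ?thesis by simp
  qed
  with H \<open>m < m'\<close> \<open>finite H\<close> show ?thesis by blast
qed

text \<open>Along a long enough chain of annihilators the distance of a functional \<open>f\<close> from two
  consecutive ones is almost the same; there a norm-minimal \<open>g\<close> agreeing with \<open>f\<close> up to the
  larger index lies near a finite set fixed in advance.\<close>

lemma LKK_star_window:
  fixes d :: "nat \<Rightarrow> 'a::real_normed_vector"
  assumes LKK: "c_LKK_star c TYPE('a)" and dense: "closure (range d) = UNIV"
    and "c > 0" "\<eta> > 0"
  shows "\<exists>M H. m < M \<and> finite H \<and> (\<forall>f. norm f \<le> 1 \<longrightarrow>
    (\<exists>g. norm g \<le> 2 \<and> g - f \<in> annihilator d m \<and> (\<exists>k\<in>H. norm (g - k) \<le> \<eta>) \<and>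
      (\<forall>z. norm z \<le> 2 \<longrightarrow> z - f \<in> annihilator d M \<longrightarrow>
         norm g + c * norm (z - g) - \<eta> \<le> norm z)))"
proof -
  \<comment> \<open>This choice makes both the net radius \<open>3 * \<theta> / c\<close> and the
    error \<open>(1 + 6 / c) * \<theta>\<close> at most \<open>\<eta>\<close>; the cap 1 later keeps
    \<open>norm g \<le> 2\<close>.\<close>
  define \<theta> where "\<theta> = min 1 (\<eta> / (1 + 6 / c))"
  have c6: "1 + 6 / c > 0" using \<open>c > 0\<close> by (simp add: add_pos_pos)
  have \<theta>: "0 < \<theta>" "\<theta> \<le> 1" using \<open>\<eta> > 0\<close> c6 by (auto simp: \<theta>_def)
  have "\<theta> \<le> \<eta> / (1 + 6 / c)" by (simp add: \<theta>_def)
  then have \<theta>1: "(1 + 6 / c) * \<theta> \<le> \<eta>" using c6 by (simp add: pos_le_divide_eq mult.commute)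
  have "0 \<le> 3 * \<theta> / c" using \<theta> \<open>c > 0\<close> by simp
  moreover have "(1 + 6 / c) * \<theta> = \<theta> + 2 * (3 * \<theta> / c)"
    using \<open>c > 0\<close> by (simp add: field_simps)
  ultimately have \<theta>2: "3 * \<theta> / c \<le> \<eta>" using \<theta>1 \<theta>(1) by linarith
  have "\<forall>i. \<exists>m' H. i < m' \<and> finite H \<and>
    (\<forall>h. norm h \<le> 2 \<longrightarrow> norm h \<le> infdist h (annihilator d i) + \<theta> \<longrightarrow>
       (\<exists>k\<in>H. norm (h - k) \<le> 3 * \<theta> / c) \<and>
       (\<forall>y\<in>annihilator d m'. norm y \<le> 4 \<longrightarrow>
          norm h + c * norm y - (1 + 6 / c) * \<theta> \<le> norm (h + y)))"
    using LKK_star_gap[OF LKK dense \<open>c > 0\<close> \<theta>(1)] by blast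
  then obtain s J where s: "\<And>i. i < s i" and J: "\<And>i. finite (J i)" and
    gap: "\<And>i. \<forall>h. norm h \<le> 2 \<longrightarrow> norm h \<le> infdist h (annihilator d i) + \<theta> \<longrightarrow>
       (\<exists>k\<in>J i. norm (h - k) \<le> 3 * \<theta> / c) \<and>
       (\<forall>y\<in>annihilator d (s i). norm y \<le> 4 \<longrightarrow>
          norm h + c * norm y - (1 + 6 / c) * \<theta> \<le> norm (h + y))"
    by metis
  define a where "a k = (s ^^ k) m" for k
  have a0: "a 0 = m" and aSuc: "a (Suc k) = s (a k)" for k by (simp_all add: a_def)
  have "strict_mono a" using s by (simp add: strict_mono_Suc_iff aSuc)
  have "0 < \<theta> / 2" using \<theta>(1) by simp
  then obtain N :: nat where N: "real N * (\<theta> / 2) > 1"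
    using reals_Archimedean3 by blast
  have "N > 0" using N by (cases N) auto
  define M where "M = a N"
  define H where "H = (\<Union>k<N. J (a k))"
  have "m < M" using \<open>strict_mono a\<close> \<open>N > 0\<close> a0 unfolding M_def by (metis strict_monoD)
  have "finite H" using J by (simp add: H_def)
  have "\<exists>g. norm g \<le> 2 \<and> g - f \<in> annihilator d m \<and> (\<exists>k\<in>H. norm (g - k) \<le> \<eta>) \<and>
      (\<forall>z. norm z \<le> 2 \<longrightarrow> z - f \<in> annihilator d M \<longrightarrow> norm g + c * norm (z - g) - \<eta> \<le> norm z)"
    if f: "norm f \<le> 1" for f
  proof -
    define \<rho> where "\<rho> i = infdist f (annihilator d i)" for i
    \<comment> \<open>Pigeonhole: the distances lie between 0 and \<open>norm f \<le> 1\<close>, so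
      they cannot grow by more than \<open>\<theta> / 2\<close> at each of \<open>N\<close>
      steps.\<close>
    have "\<exists>k<N. \<rho> (a (Suc k)) \<le> \<rho> (a k) + \<theta> / 2"
    proof (rule ccontr)
      assume "\<not> ?thesis"
      then have *: "\<rho> (a k) + \<theta> / 2 < \<rho> (a (Suc k))" if "k < N" for k
        using that by (meson not_le)
      have "real k * (\<theta> / 2) \<le> \<rho> (a k)" if "k \<le> N" for k
        using that
      proof (induction k)
        case 0
        then show ?case by (simp add: \<rho>_def infdist_nonneg)
      next
        case (Suc k)
        then show ?case using *[of k] by (simp add: algebra_simps)
      qed
      from this[of N] N f infdist_annihilator_le_norm[of f d "a N"] show False
        by (simp add: \<rho>_def)
    qed
    then obtain k where k: "k < N" "\<rho> (a (Suc k)) \<le> \<rho> (a k) + \<theta> / 2" by blast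
    define i p where "i = a k" and "p = a (Suc k)"
    have ip: "m \<le> i" "i \<le> p" "p \<le> M"
      using \<open>strict_mono a\<close> k(1) a0 strict_mono_less_eq[of a]
      unfolding i_def p_def M_def by (metis le0 , simp, simp add: Suc_leI)
    \<comment> \<open>Half of \<open>\<theta>\<close> is spent on almost attaining the distance at
      \<open>p\<close>, the other half on the growth from \<open>i\<close> to \<open>p\<close>;
      together they give the hypothesis of \<open>gap\<close> at \<open>i\<close>.\<close>
    obtain v where v: "v \<in> annihilator d p" "norm (f - v) < \<rho> p + \<theta> / 2"
      using infdist_annihilator_attained[of "\<theta> / 2" d p f] \<theta>(1) unfolding \<rho>_def by auto
    define g where "g = f - v"
    have g1: "norm g \<le> 2"
      using v(2) infdist_annihilator_le_norm[of f d p] f \<theta>(2) unfolding g_def \<rho>_def by linarith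
    have vi: "v \<in> annihilator d i" using v(1) annihilator_antimono[OF ip(2)] by blast
    have "infdist g (annihilator d i) = \<rho> i"
      unfolding g_def \<rho>_def by (rule infdist_annihilator_diff[OF vi])
    then have g2: "norm g \<le> infdist g (annihilator d i) + \<theta>"
      using v(2) k(2) unfolding g_def i_def p_def by linarith
    have "g - f \<in> annihilator d i"
      using annihilator_diff[OF annihilator_zero vi] by (simp add: g_def)
    then have "g - f \<in> annihilator d m" using annihilator_antimono[OF ip(1)] by blast
    moreover have "\<exists>k\<in>H. norm (g - k) \<le> \<eta>"
    proof -
      obtain k' where "k' \<in> J i" "norm (g - k') \<le> 3 * \<theta> / c" using gap g1 g2 by blast
      then show ?thesis using \<theta>2 k(1) unfolding H_def i_def by force
    qed
    moreover have "norm g + c * norm (z - g) - \<eta> \<le> norm z"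
      if z: "norm z \<le> 2" "z - f \<in> annihilator d M" for z
    proof -
      have "z - f \<in> annihilator d p" using z(2) annihilator_antimono[OF ip(3)] by blast
      \<comment> \<open>Here \<open>p\<close> equals \<open>s i\<close>, so agreement with
        \<open>f\<close> up to \<open>p\<close> is exactly what \<open>gap\<close> requires of the
        increment \<open>z - g\<close>.\<close>
      then have "(z - f) + v \<in> annihilator d (s i)"
        using v(1) annihilator_add by (metis aSuc i_def p_def)
      then have zg: "z - g \<in> annihilator d (s i)" by (simp add: g_def algebra_simps)
      have "norm (z - g) \<le> 4" using norm_triangle_ineq4[of z g] z(1) g1 by linarith
      then have "norm g + c * norm (z - g) - (1 + 6 / c) * \<theta> \<le> norm (g + (z - g))"
        using gap g1 g2 zg by blast
      then show ?thesis using \<theta>1 by simp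
    qed
    ultimately show ?thesis using g1 by blast
  qed
  with \<open>m < M\<close> \<open>finite H\<close> show ?thesis by blast
qed

section \<open>Decomposition over finite nets and a norming weak-star null sequence\<close>

text \<open>Each centre close to \<open>A\<close> is replaced by a point of \<open>A\<close>, at the
  price of doubling the radius. This puts the net for the differences inside an annihilator, as
  weak-star nullity will require.\<close>

lemma finite_net_within:
  fixes A :: "'a::metric_space set"
  assumes "finite P"
  shows "\<exists>F. finite F \<and> F \<subseteq> A \<and> (\<forall>x\<in>A. (\<exists>p\<in>P. dist x p \<le> \<theta>) \<longrightarrow> (\<exists>u\<in>F. dist x u \<le> 2 * \<theta>))"
proof -
  define Q where "Q = {p\<in>P. \<exists>x\<in>A. dist x p \<le> \<theta>}"
  have "\<forall>p\<in>Q. \<exists>x. x \<in> A \<and> dist x p \<le> \<theta>" by (auto simp: Q_def)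
  then obtain w where w: "\<And>p. p \<in> Q \<Longrightarrow> w p \<in> A \<and> dist (w p) p \<le> \<theta>" by metis
  have "\<exists>u\<in>w ` Q. dist x u \<le> 2 * \<theta>" if "x \<in> A" "p \<in> P" "dist x p \<le> \<theta>" for x p
  proof
    have "p \<in> Q" using that by (auto simp: Q_def)
    then show "w p \<in> w ` Q" by simp
    show "dist x (w p) \<le> 2 * \<theta>"
      using w[OF \<open>p \<in> Q\<close>] that(3) dist_triangle2[of x "w p" p] by linarith
  qed
  moreover have "finite (w ` Q)" using assms by (simp add: Q_def)
  moreover have "w ` Q \<subseteq> A" using w by blast
  ultimately show ?thesis by blast
qed

text \<open>The windows, and hence the sets \<open>F k\<close>, are fixed before \<open>j\<close>;
  only the choice of \<open>u\<close> depends on the functional norming \<open>d j\<close>. Its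
  approximants \<open>g k\<close> telescope, and the Kadec-Klee estimate bounds the total length of
  their differences. With truncated subtraction both \<open>F 0\<close> and \<open>F 1\<close> are
  unrestricted.\<close>

lemma LKK_star_decomposition:
  fixes d :: "nat \<Rightarrow> 'a::real_normed_vector"
  assumes LKK: "c_LKK_star c TYPE('a)" and dense: "closure (range d) = UNIV"
    and "c > 0" "c \<le> 1" "\<tau> > 0"
  shows "\<exists>F. (\<forall>k. finite (F k) \<and> F k \<subseteq> annihilator d (k - 1)) \<and>
    (\<forall>j. \<exists>n u. (\<forall>k\<le>n. u k \<in> F k) \<and> (\<Sum>k\<le>n. norm (u k)) \<le> (1 + \<tau>) / c + \<tau> \<and>
       (1 - \<tau>) * norm (d j) \<le> (\<Sum>k\<le>n. \<bar>blinfun_apply (u k) (d j)\<bar>))"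
proof -
  \<comment> \<open>The errors sum to at most \<open>\<tau> / 8\<close>, so even eight times their
    sum stays within \<open>\<tau>\<close>.\<close>
  define \<eta> where "\<eta> k = \<tau> / 16 * (1 / 2) ^ k" for k :: nat
  have \<eta>: "\<eta> k > 0" for k using \<open>\<tau> > 0\<close> by (simp add: \<eta>_def)
  have \<eta>Suc: "\<eta> (Suc k) = \<eta> k / 2" for k by (simp add: \<eta>_def)
  have \<eta>sum: "(\<Sum>k\<le>n. \<eta> k) \<le> \<tau> / 8" for n
  proof -
    have "(\<Sum>k\<le>n. \<eta> k) = \<tau> / 8 - \<eta> n"
      by (induction n) (simp_all add: \<eta>Suc, simp add: \<eta>_def)
    then show ?thesis using \<eta>[of n] by simp
  qed
  define W where "W m k M H \<longleftrightarrow> m < M \<and> finite H \<and> (\<forall>f. norm f \<le> 1 \<longrightarrow>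
    (\<exists>g. norm g \<le> 2 \<and> g - f \<in> annihilator d m \<and> (\<exists>h\<in>H. norm (g - h) \<le> \<eta> k) \<and>
      (\<forall>z. norm z \<le> 2 \<longrightarrow> z - f \<in> annihilator d M \<longrightarrow>
         norm g + c * norm (z - g) - \<eta> k \<le> norm z)))" for m k M and H :: "('a \<Rightarrow>\<^sub>L real) set"
  have "\<forall>m k. \<exists>M H. W m k M H"
    unfolding W_def using LKK_star_window[OF LKK dense \<open>c > 0\<close> \<eta>] by blast
  then obtain Mf Hf where W: "\<And>m k. W m k (Mf m k) (Hf m k)" by metis
  define m where "m = rec_nat 0 (\<lambda>k i. Mf i k)"
  define H where "H k = Hf (m k) k" for k
  have WH: "W (m k) k (m (Suc k)) (H k)" for k
    using W[of "m k" k] by (simp add: m_def H_def)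
  have "strict_mono m" using WH by (simp add: strict_mono_Suc_iff W_def)
  then have m_ge: "k \<le> m k" for k by (rule strict_mono_imp_increasing)
  have H: "finite (H k)" for k using WH by (simp add: W_def)
  \<comment> \<open>Centres for the increments \<open>g k - g (k - 1)\<close> are differences of
    centres from consecutive windows; the first increment is \<open>g 0\<close> itself.\<close>
  define P where "P k = (if k = 0 then H 0 else (\<lambda>(x, y). x - y) ` (H k \<times> H (k - 1)))" for k
  have finP: "finite (P k)" for k using H by (simp add: P_def)
  have "\<forall>k. \<exists>F. finite F \<and> F \<subseteq> annihilator d (k - 1) \<and>
      (\<forall>x\<in>annihilator d (k - 1). (\<exists>p\<in>P k. dist x p \<le> 4 * \<eta> k) \<longrightarrow> (\<exists>u\<in>F. dist x u \<le> 2 * (4 * \<eta> k)))"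
    by (intro allI finite_net_within finP)
  then obtain F where F: "\<And>k. finite (F k)" "\<And>k. F k \<subseteq> annihilator d (k - 1)"
    and net: "\<And>k x. x \<in> annihilator d (k - 1) \<Longrightarrow> \<exists>p\<in>P k. dist x p \<le> 4 * \<eta> k \<Longrightarrow>
      \<exists>u\<in>F k. dist x u \<le> 2 * (4 * \<eta> k)"
    by metis
  have "\<exists>n u. (\<forall>k\<le>n. u k \<in> F k) \<and> (\<Sum>k\<le>n. norm (u k)) \<le> (1 + \<tau>) / c + \<tau> \<and>
       (1 - \<tau>) * norm (d j) \<le> (\<Sum>k\<le>n. \<bar>blinfun_apply (u k) (d j)\<bar>)" for j
  proof -
    obtain f :: "'a \<Rightarrow>\<^sub>L real" where f: "norm f \<le> 1" "blinfun_apply f (d j) = norm (d j)"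
      using norming_functional by blast
    have "\<forall>k. \<exists>g. norm g \<le> 2 \<and> g - f \<in> annihilator d (m k) \<and> (\<exists>h\<in>H k. norm (g - h) \<le> \<eta> k) \<and>
      (\<forall>z. norm z \<le> 2 \<longrightarrow> z - f \<in> annihilator d (m (Suc k)) \<longrightarrow>
         norm g + c * norm (z - g) - \<eta> k \<le> norm z)"
      using WH f(1) unfolding W_def by blast
    then obtain g where g2: "\<And>k. norm (g k) \<le> 2" and gf: "\<And>k. g k - f \<in> annihilator d (m k)"
      and gH: "\<And>k. \<exists>h\<in>H k. norm (g k - h) \<le> \<eta> k"
      and gz: "\<And>k z. norm z \<le> 2 \<Longrightarrow> z - f \<in> annihilator d (m (Suc k)) \<Longrightarrow>
         norm (g k) + c * norm (z - g k) - \<eta> k \<le> norm z"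
      by metis
    \<comment> \<open>The functional \<open>f\<close> itself is an admissible \<open>z\<close> in
      every window.\<close>
    have g1: "norm (g k) \<le> 1 + \<eta> k" for k
    proof -
      have "norm (g k) + c * norm (f - g k) - \<eta> k \<le> norm f"
        using f(1) by (intro gz) auto
      moreover have "0 \<le> c * norm (f - g k)" using \<open>c > 0\<close> by simp
      ultimately show ?thesis using f(1) by linarith
    qed
    define e where "e k = (if k = 0 then g 0 else g k - g (k - 1))" for k
    have esum: "(\<Sum>k\<le>n. e k) = g n" for n
      by (induction n) (simp_all add: e_def)
    \<comment> \<open>Each window is tested with the next approximant, and the norms telescope. The
      hypothesis \<open>c \<le> 1\<close> enters in the base case, where the full norm of
      \<open>g 0\<close> is available.\<close>
    have enorm: "c * (\<Sum>k\<le>n. norm (e k)) \<le> norm (g n) + (\<Sum>k<n. \<eta> k)" for n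
    proof (induction n)
      case 0
      then show ?case using \<open>c \<le> 1\<close> mult_right_mono[of c 1 "norm (g 0)"] by (simp add: e_def)
    next
      case (Suc n)
      have "norm (g n) + c * norm (g (Suc n) - g n) - \<eta> n \<le> norm (g (Suc n))"
        by (intro gz g2 gf)
      with Suc show ?case by (simp add: e_def algebra_simps)
    qed
    have eA: "e k \<in> annihilator d (k - 1)" for k
    proof (cases k)
      case 0
      then show ?thesis by (simp add: annihilator_def)
    next
      case (Suc i)
      have "g k - f \<in> annihilator d (m i)"
        using gf[of k] annihilator_antimono[of "m i" "m k"] \<open>strict_mono m\<close> Suc
        by (metis strict_mono_less_eq le_Suc_eq order_refl subsetD)
      then have "(g k - f) - (g i - f) \<in> annihilator d (m i)"
        using gf[of i] by (rule annihilator_diff)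
      then show ?thesis
        using Suc annihilator_antimono[OF m_ge[of i], of d] by (auto simp: e_def)
    qed
    have eP: "\<exists>p\<in>P k. dist (e k) p \<le> 4 * \<eta> k" for k
    proof (cases k)
      case 0
      obtain h where "h \<in> H 0" "norm (g 0 - h) \<le> \<eta> 0" using gH by blast
      then show ?thesis using 0 \<eta>[of 0] by (auto simp: P_def e_def dist_norm intro!: bexI[of _ h])
    next
      case (Suc i)
      obtain h where h: "h \<in> H k" "norm (g k - h) \<le> \<eta> k" using gH by blast
      obtain h' where h': "h' \<in> H i" "norm (g i - h') \<le> \<eta> i" using gH by blast
      have "h - h' \<in> P k" using Suc h(1) h'(1) by (auto simp: P_def)
      moreover have "norm (g k - g i - (h - h')) \<le> norm (g k - h) + norm (g i - h')"
        using norm_triangle_ineq4[of "g k - h" "g i - h'"] by (simp add: algebra_simps)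
      then have "dist (e k) (h - h') \<le> 4 * \<eta> k"
        using h(2) h'(2) \<eta>[of i] Suc \<eta>Suc[of i] by (simp add: e_def dist_norm)
      ultimately show ?thesis by blast
    qed
    have "\<forall>k. \<exists>u. u \<in> F k \<and> dist (e k) u \<le> 2 * (4 * \<eta> k)" using net[OF eA eP] by blast
    then obtain u where uF: "\<And>k. u k \<in> F k" and ue: "\<And>k. norm (e k - u k) \<le> 8 * \<eta> k"
      by (auto simp: dist_norm dest!: choice)
    \<comment> \<open>Since \<open>j < n \<le> m n\<close>, the approximant \<open>g n\<close>
      agrees with \<open>f\<close> at \<open>d j\<close> and so attains \<open>norm (d j)\<close>
      there.\<close>
    define n where "n = Suc j"
    have usum: "(\<Sum>k\<le>n. norm (e k - u k)) \<le> \<tau>"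
    proof -
      have "(\<Sum>k\<le>n. norm (e k - u k)) \<le> (\<Sum>k\<le>n. 8 * \<eta> k)" by (intro sum_mono ue)
      also have "\<dots> \<le> \<tau>" using \<eta>sum[of n] by (simp add: sum_distrib_left[symmetric])
      finally show ?thesis .
    qed
    have "(\<Sum>k\<le>n. norm (u k)) \<le> (\<Sum>k\<le>n. norm (e k) + norm (e k - u k))"
      by (intro sum_mono) (metis norm_minus_commute norm_triangle_sub)
    also have "\<dots> \<le> (\<Sum>k\<le>n. norm (e k)) + \<tau>" using usum by (simp add: sum.distrib)
    also have "(\<Sum>k\<le>n. norm (e k)) \<le> (1 + \<tau>) / c"
    proof -
      have "c * (\<Sum>k\<le>n. norm (e k)) \<le> 1 + (\<Sum>k\<le>n. \<eta> k)"
        using enorm[of n] g1[of n] by (simp add: lessThan_Suc_atMost[symmetric])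
      also have "\<dots> \<le> 1 + \<tau>" using \<eta>sum[of n] \<open>\<tau> > 0\<close> by linarith
      finally show ?thesis using \<open>c > 0\<close> by (simp add: field_simps)
    qed
    finally have 1: "(\<Sum>k\<le>n. norm (u k)) \<le> (1 + \<tau>) / c + \<tau>" by simp
    have "j < m n" using m_ge[of n] by (simp add: n_def)
    then have "blinfun_apply (g n) (d j) = norm (d j)"
      using gf[of n] f(2) by (simp add: annihilator_def blinfun.diff_left)
    then have "norm (d j) = (\<Sum>k\<le>n. blinfun_apply (e k) (d j))"
      using esum[of n] by (metis blinfun.sum_left)
    also have "\<dots> \<le> (\<Sum>k\<le>n. \<bar>blinfun_apply (u k) (d j)\<bar> + norm (e k - u k) * norm (d j))"
    proof (rule sum_mono)
      fix k
      show "blinfun_apply (e k) (d j) \<le> \<bar>blinfun_apply (u k) (d j)\<bar> + norm (e k - u k) * norm (d j)"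
        using norm_blinfun[of "e k - u k" "d j"] by (simp add: blinfun.diff_left)
    qed
    also have "\<dots> = (\<Sum>k\<le>n. \<bar>blinfun_apply (u k) (d j)\<bar>) + (\<Sum>k\<le>n. norm (e k - u k)) * norm (d j)"
      by (simp add: sum.distrib sum_distrib_right)
    also have "\<dots> \<le> (\<Sum>k\<le>n. \<bar>blinfun_apply (u k) (d j)\<bar>) + \<tau> * norm (d j)"
      using usum by (intro add_left_mono mult_right_mono) auto
    finally have "(1 - \<tau>) * norm (d j) \<le> (\<Sum>k\<le>n. \<bar>blinfun_apply (u k) (d j)\<bar>)"
      by (simp add: algebra_simps)
    with 1 uF show ?thesis by blast
  qed
  with F show ?thesis by blast
qed

text \<open>All members of the sets \<open>F k\<close> are normalised and listed in one sequence.
  Only the finitely many with \<open>k \<le> Suc j\<close> can be nonzero at \<open>d j\<close>, so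
  it is weak-star null; the decomposition makes it norming on a dense set, and continuity extends
  this to the whole space.\<close>

lemma LKK_star_norming_sequence:
  assumes LKK: "c_LKK_star c TYPE('a::real_normed_vector)" and sep: "separable_space TYPE('a)"
    and "c > 0" "c \<le> 1" "\<epsilon> > 0"
  shows "\<exists>\<phi> :: nat \<Rightarrow> 'a \<Rightarrow>\<^sub>L real. weak_star_null \<phi> \<and> (\<forall>n. norm (\<phi> n) \<le> 1) \<and>
    (\<forall>x. norm x \<le> (1 / c + \<epsilon>) * (SUP n. \<bar>blinfun_apply (\<phi> n) x\<bar>))"
proof -
  obtain D :: "'a set" where D: "countable D" "closure D = UNIV"
    using sep unfolding separable_space_def by blast
  then have "D \<noteq> {}" by auto
  define d where "d = from_nat_into D"
  have dense: "closure (range d) = UNIV"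
    using D \<open>D \<noteq> {}\<close> by (simp add: d_def range_from_nat_into)
  \<comment> \<open>This value solves \<open>(1 + \<tau>) / c + \<tau> = (1 - \<tau>) * (1 / c +
    \<epsilon>)\<close>.\<close>
  define \<tau> where "\<tau> = \<epsilon> / (2 / c + 1 + \<epsilon>)"
  have pos: "2 / c + 1 + \<epsilon> > 0" using \<open>c > 0\<close> \<open>\<epsilon> > 0\<close> by (simp add: add_pos_pos)
  have \<tau>: "\<tau> > 0" "\<tau> < 1" using \<open>c > 0\<close> \<open>\<epsilon> > 0\<close> pos by (auto simp: \<tau>_def add_pos_pos)
  have \<tau>eq: "\<tau> * (2 / c + 1 + \<epsilon>) = \<epsilon>" using pos by (simp add: \<tau>_def)
  have const: "(1 + \<tau>) / c + \<tau> = (1 - \<tau>) * (1 / c + \<epsilon>)"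
  proof -
    have "(1 + \<tau>) * b + \<tau> = (1 - \<tau>) * (b + \<epsilon>)" if "\<tau> * (2 * b + 1 + \<epsilon>) = \<epsilon>" for b
      using that by (simp add: algebra_simps)
    from this[of "1 / c"] \<tau>eq show ?thesis by simp
  qed
  define K where "K = (1 + \<tau>) / c + \<tau>"
  obtain F where F: "\<And>k. finite (F k)" "\<And>k. F k \<subseteq> annihilator d (k - 1)"
    and dec: "\<And>j. \<exists>n u. (\<forall>k\<le>n. u k \<in> F k) \<and> (\<Sum>k\<le>n. norm (u k)) \<le> K \<and>
       (1 - \<tau>) * norm (d j) \<le> (\<Sum>k\<le>n. \<bar>blinfun_apply (u k) (d j)\<bar>)"
    using LKK_star_decomposition[OF LKK dense \<open>c > 0\<close> \<open>c \<le> 1\<close> \<tau>(1)] unfolding K_def by blast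
  have "\<forall>k. \<exists>xs. set xs = F k" using F(1) finite_list by blast
  then obtain L where L: "\<And>k. set (L k) = F k" by metis
  \<comment> \<open>Index pairs beyond the end of the list \<open>L k\<close> are filled with the
    zero functional.\<close>
  define \<phi> where "\<phi> n = (case prod_decode n of (k, i) \<Rightarrow> if i < length (L k) then sgn (L k ! i) else 0)"
    for n
  have \<phi>1: "norm (\<phi> n) \<le> 1" for n
    by (simp add: \<phi>_def norm_sgn split: prod.split)
  have \<phi>F: "\<exists>n. \<phi> n = sgn u" if u: "u \<in> F k" for u k
  proof -
    obtain i where "i < length (L k)" "L k ! i = u"
      using u L[of k] by (metis in_set_conv_nth)
    then have "\<phi> (prod_encode (k, i)) = sgn u" by (simp add: \<phi>_def)
    then show ?thesis ..
  qed
  have "weak_star_null \<phi>"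
  proof (rule weak_star_nullI_dense[OF dense \<phi>1])
    fix j
    have "{n. blinfun_apply (\<phi> n) (d j) \<noteq> 0} \<subseteq>
        prod_encode ` (SIGMA k:{..Suc j}. {..<length (L k)})"
    proof
      fix n assume n: "n \<in> {n. blinfun_apply (\<phi> n) (d j) \<noteq> 0}"
      obtain k i where ki: "prod_decode n = (k, i)" by fastforce
      have i: "i < length (L k)" using n ki by (auto simp: \<phi>_def split: if_splits)
      then have "L k ! i \<in> annihilator d (k - 1)" using F(2) L by (metis nth_mem subsetD)
      moreover have "blinfun_apply (L k ! i) (d j) \<noteq> 0"
        using n ki i by (auto simp: \<phi>_def sgn_div_norm blinfun.scaleR_left)
      ultimately have "\<not> j < k - 1" by (auto simp: annihilator_def)
      then have "k \<le> Suc j" by simp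
      moreover have "n = prod_encode (k, i)" using ki by (metis prod_decode_inverse)
      ultimately show "n \<in> prod_encode ` (SIGMA k:{..Suc j}. {..<length (L k)})"
        using i by auto
    qed
    then have "finite {n. blinfun_apply (\<phi> n) (d j) \<noteq> 0}"
      by (rule finite_subset) auto
    then have "eventually (\<lambda>n. blinfun_apply (\<phi> n) (d j) = 0) sequentially"
      by (simp add: eventually_cofinite flip: cofinite_eq_sequentially)
    then show "(\<lambda>n. blinfun_apply (\<phi> n) (d j)) \<longlonglongrightarrow> 0" by (rule tendsto_eventually)
  qed
  define S where "S x = (SUP n. \<bar>blinfun_apply (\<phi> n) x\<bar>)" for x
  have bd: "\<bar>blinfun_apply (\<phi> n) x\<bar> \<le> norm x" for n x
    using norm_blinfun[of "\<phi> n" x] mult_right_mono[OF \<phi>1[of n] norm_ge_zero[of x]] by simp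
  have upper: "\<bar>blinfun_apply (\<phi> n) x\<bar> \<le> S x" for n x
    unfolding S_def by (rule cSUP_upper) (use bd in \<open>auto intro!: bdd_aboveI2\<close>)
  have S0: "0 \<le> S x" for x using upper[of 0 x] abs_ge_zero order_trans by blast
  have lip: "S x \<le> S y + dist x y" for x y
  proof -
    have "\<bar>blinfun_apply (\<phi> n) x\<bar> \<le> S y + dist x y" for n
      using upper[of n y] bd[of n "x - y"] by (simp add: blinfun.diff_right dist_norm)
    then show ?thesis unfolding S_def[of x] by (intro cSUP_least) auto
  qed
  \<comment> \<open>Continuity of the supremum makes the norming inequality a closed condition, so
    it passes from \<open>range d\<close> to its closure.\<close>
  have "1-lipschitz_on UNIV S"
  proof (rule lipschitz_onI)
    show "dist (S x) (S y) \<le> 1 * dist x y" for x y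
      using lip[of x y] lip[of y x] by (simp add: dist_real_def dist_commute abs_le_iff)
  qed simp
  then have "continuous_on UNIV S" by (rule lipschitz_on_continuous_on)
  then have "closed {x. (1 - \<tau>) * norm x \<le> K * S x}"
    by (intro closed_Collect_le continuous_intros)
  moreover have "range d \<subseteq> {x. (1 - \<tau>) * norm x \<le> K * S x}"
  proof safe
    fix j
    obtain n u where u: "\<forall>k\<le>n. u k \<in> F k" "(\<Sum>k\<le>n. norm (u k)) \<le> K"
       "(1 - \<tau>) * norm (d j) \<le> (\<Sum>k\<le>n. \<bar>blinfun_apply (u k) (d j)\<bar>)"
      using dec by blast
    have "\<bar>blinfun_apply (u k) (d j)\<bar> \<le> norm (u k) * S (d j)" if k: "k \<le> n" for k
    proof -
      obtain i where i: "\<phi> i = sgn (u k)" using \<phi>F u(1) k by blast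
      have "\<bar>blinfun_apply (u k) (d j)\<bar> = norm (u k) * \<bar>blinfun_apply (sgn (u k)) (d j)\<bar>"
        by (cases "u k = 0") (simp_all add: sgn_div_norm blinfun.scaleR_left abs_mult)
      also have "\<dots> \<le> norm (u k) * S (d j)"
        using upper[of i "d j"] i by (intro mult_left_mono) auto
      finally show ?thesis .
    qed
    then have "(\<Sum>k\<le>n. \<bar>blinfun_apply (u k) (d j)\<bar>) \<le> (\<Sum>k\<le>n. norm (u k)) * S (d j)"
      unfolding sum_distrib_right by (intro sum_mono) auto
    also have "\<dots> \<le> K * S (d j)" by (intro mult_right_mono u S0)
    finally show "(1 - \<tau>) * norm (d j) \<le> K * S (d j)" using u(3) by simp
  qed
  ultimately have "closure (range d) \<subseteq> {x. (1 - \<tau>) * norm x \<le> K * S x}"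
    by (rule closure_minimal[rotated])
  then have "(1 - \<tau>) * norm x \<le> (1 - \<tau>) * ((1 / c + \<epsilon>) * S x)" for x
    using dense const by (auto simp: K_def mult.assoc)
  then have "norm x \<le> (1 / c + \<epsilon>) * S x" for x
    using \<tau>(2) by (meson mult_le_cancel_left_pos diff_gt_0_iff_gt)
  with \<open>weak_star_null \<phi>\<close> \<phi>1 show ?thesis unfolding S_def by blast
qed

section \<open>Embedding into the space of null sequences\<close>

text \<open>Evaluation along \<open>\<phi>\<close> has norm at most 1, and the norming inequality
  bounds its inverse by \<open>K\<close>. The same inequality pulls Cauchy sequences back to the
  complete space \<open>'a\<close>, so the range is closed.\<close>

lemma c0_embedding_of_norming_sequence:
  fixes \<phi> :: "nat \<Rightarrow> 'a::banach \<Rightarrow>\<^sub>L real"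
  assumes null: "weak_star_null \<phi>" and \<phi>1: "\<And>n. norm (\<phi> n) \<le> 1"
    and lower: "\<And>x. norm x \<le> K * (SUP n. \<bar>blinfun_apply (\<phi> n) x\<bar>)" and "K > 0"
  shows "\<exists>E. c0_linear_subspace E \<and> c0_closed E \<and> bm_dist_c0 TYPE('a) E \<le> ereal K"
proof -
  define T where "T x = (\<lambda>n. blinfun_apply (\<phi> n) x)" for x
  define E where "E = range T"
  have bd: "\<bar>T x n\<bar> \<le> norm x" for x n
    using norm_blinfun[of "\<phi> n" x] mult_right_mono[OF \<phi>1[of n] norm_ge_zero[of x]]
    by (simp add: T_def)
  have T_le: "c0_norm (T x) \<le> norm x" for x
    unfolding c0_norm_def using bd by (intro cSUP_least) auto
  have T_ge: "norm x \<le> K * c0_norm (T x)" for x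
    using lower[of x] by (simp add: c0_norm_def T_def)
  have add: "T (x + y) = (\<lambda>n. T x n + T y n)" and scale: "T (a *\<^sub>R x) = (\<lambda>n. a * T x n)"
    and diff: "T (x - y) = (\<lambda>n. T x n - T y n)" for x y a
    by (simp_all add: T_def blinfun.add_right blinfun.scaleR_right blinfun.diff_right)
  have Tc0: "T x \<in> c0" for x using null by (simp add: T_def c0_def weak_star_null_def)
  have T0: "T 0 = (\<lambda>n. 0)" by (simp add: T_def)
  have inj: "inj T"
  proof (rule injI)
    fix x y assume "T x = T y"
    then have "T (x - y) = (\<lambda>n. 0)" by (simp add: diff)
    then have "norm (x - y) \<le> 0" using T_ge[of "x - y"] by (simp add: c0_norm_def)
    then show "x = y" by simp
  qed
  have "c0_linear_subspace E"
    unfolding c0_linear_subspace_def E_def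
  proof (intro conjI ballI allI impI)
    show "range T \<subseteq> c0" using Tc0 by blast
    show "(\<lambda>n. 0) \<in> range T" using T0 by (metis rangeI)
    show "(\<lambda>n. f n + g n) \<in> range T" if fg: "f \<in> range T" "g \<in> range T" for f g
    proof -
      obtain x y where "f = T x" "g = T y" using fg by blast
      then have "(\<lambda>n. f n + g n) = T (x + y)" by (simp add: add)
      then show ?thesis by simp
    qed
    show "(\<lambda>n. a * f n) \<in> range T" if f: "f \<in> range T" for a f
    proof -
      obtain x where "f = T x" using f by blast
      then have "(\<lambda>n. a * f n) = T (a *\<^sub>R x)" by (simp add: scale)
      then show ?thesis by simp
    qed
  qed
  moreover have "c0_closed E"
    unfolding c0_closed_def
  proof (intro allI impI, elim conjE)
    fix g f
    assume gE: "\<forall>k. g k \<in> E" and f: "f \<in> c0" and lim: "(\<lambda>k. c0_norm (\<lambda>n. g k n - f n)) \<longlonglongrightarrow> 0"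
    have "\<forall>k. \<exists>x. g k = T x" using gE by (auto simp: E_def)
    then obtain x where x: "\<And>k. g k = T (x k)" by metis
    define q where "q k = c0_norm (\<lambda>n. g k n - f n)" for k
    have gf: "\<bar>T (x k) n - f n\<bar> \<le> q k" for k n
    proof -
      \<comment> \<open>Boundedness of \<open>f\<close> makes the supremum defining
        \<open>c0_norm\<close> a true upper bound for the coordinates.\<close>
      have "Bseq f" using f by (auto simp: c0_def intro: convergent_imp_Bseq convergentI)
      then obtain B where B: "\<And>n. \<bar>f n\<bar> \<le> B" by (auto simp: Bseq_def)
      have "bdd_above (range (\<lambda>n. \<bar>g k n - f n\<bar>))"
      proof (rule bdd_aboveI2)
        show "\<bar>g k n - f n\<bar> \<le> norm (x k) + B" for n
          using bd[of "x k" n] B[of n] x[of k] by simp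
      qed
      then show ?thesis
        unfolding q_def c0_norm_def x[symmetric] by (rule cSUP_upper[rotated]) simp
    qed
    have xx: "norm (x k - x l) \<le> K * (q k + q l)" for k l
    proof -
      have "\<bar>T (x k - x l) n\<bar> \<le> q k + q l" for n
        using gf[of k n] gf[of l n] unfolding diff by linarith
      then have "c0_norm (T (x k - x l)) \<le> q k + q l"
        unfolding c0_norm_def by (intro cSUP_least) auto
      then show ?thesis
        using T_ge[of "x k - x l"] \<open>K > 0\<close> by (meson mult_left_mono order_less_imp_le order_trans)
    qed
    have "Cauchy x"
    proof (rule CauchyI)
      fix e :: real assume "e > 0"
      then have "e / (2 * K) > 0" using \<open>K > 0\<close> by simp
      then obtain N where N: "\<And>k. k \<ge> N \<Longrightarrow> q k < e / (2 * K)"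
        using order_tendstoD(2)[OF lim] unfolding eventually_sequentially q_def by blast
      have "norm (x k - x l) < e" if "k \<ge> N" "l \<ge> N" for k l
      proof -
        have "q k + q l < e / K" using N[OF that(1)] N[OF that(2)] by (simp add: field_simps)
        then have "K * (q k + q l) < e" using \<open>K > 0\<close> by (simp add: field_simps)
        then show ?thesis using xx[of k l] by linarith
      qed
      then show "\<exists>M. \<forall>m\<ge>M. \<forall>n\<ge>M. norm (x m - x n) < e" by blast
    qed
    then obtain y where y: "x \<longlonglongrightarrow> y" using Cauchy_convergent convergent_def by blast
    have "T y n = f n" for n
    proof (rule LIMSEQ_unique)
      show "(\<lambda>k. T (x k) n) \<longlonglongrightarrow> T y n"
        unfolding T_def by (intro tendsto_intros y)
      have "(\<lambda>k. T (x k) n - f n) \<longlonglongrightarrow> 0"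
        by (rule Lim_null_comparison[OF _ lim]) (use gf in \<open>simp add: q_def\<close>)
      then show "(\<lambda>k. T (x k) n) \<longlonglongrightarrow> f n" by (rule LIM_zero_cancel)
    qed
    then have "T y = f" by blast
    then show "f \<in> E" by (auto simp: E_def)
  qed
  moreover have "bm_dist_c0 TYPE('a) E \<le> ereal K"
  proof -
    have "opnorm_to_c0 T \<le> 1"
      unfolding opnorm_to_c0_def
    proof (rule SUP_least)
      fix x :: 'a assume "x \<in> {x. norm x \<le> 1}"
      then show "ereal (c0_norm (T x)) \<le> 1" using T_le[of x] by simp
    qed
    moreover have "opnorm_from_c0 E (inv_into UNIV T) \<le> ereal K"
      unfolding opnorm_from_c0_def
    proof (rule SUP_least)
      fix y assume "y \<in> {y \<in> E. c0_norm y \<le> 1}"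
      then obtain x where x: "y = T x" "c0_norm (T x) \<le> 1" by (auto simp: E_def)
      have "norm x \<le> K"
        using order_trans[OF T_ge[of x] mult_left_mono[OF x(2), of K]] \<open>K > 0\<close> by simp
      then show "ereal (norm (inv_into UNIV T y)) \<le> ereal K" using x inj by simp
    qed
    \<comment> \<open>Monotonicity of the product in \<open>ereal\<close> is applied with this sign
      condition; the zero vector witnesses it.\<close>
    moreover have "0 \<le> opnorm_from_c0 E (inv_into UNIV T)"
      unfolding opnorm_from_c0_def
    proof (rule SUP_upper2)
      show "T 0 \<in> {y \<in> E. c0_norm y \<le> 1}" using T_le[of 0] by (simp add: E_def)
    qed simp
    ultimately have "opnorm_to_c0 T * opnorm_from_c0 E (inv_into UNIV T) \<le> 1 * ereal K"
      by (intro ereal_mult_mono) auto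
    moreover have "bm_dist_c0 TYPE('a) E \<le> opnorm_to_c0 T * opnorm_from_c0 E (inv_into UNIV T)"
      unfolding bm_dist_c0_def
    proof (rule INF_lower)
      show "T \<in> {T. linear_to_seq T \<and> bij_betw T UNIV E}"
        using add scale inj by (simp add: linear_to_seq_def E_def bij_betw_def)
    qed
    ultimately show ?thesis by simp
  qed
  ultimately show ?thesis by blast
qed

theorem theorem2p4:
  fixes c :: real
  assumes "0 < c" and "c \<le> 1"
    and "separable_space TYPE('a::banach)"
    and "c_LKK_star c TYPE('a)"
  shows "\<forall>\<epsilon>>0. \<exists>E. c0_linear_subspace E \<and> c0_closed E \<and>
           bm_dist_c0 TYPE('a) E \<le> ereal (1 / c^2 + \<epsilon>)"
proof (intro allI impI)
  fix \<epsilon> :: real assume "\<epsilon> > 0"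
  obtain \<phi> :: "nat \<Rightarrow> 'a \<Rightarrow>\<^sub>L real" where \<phi>: "weak_star_null \<phi>" "\<And>n. norm (\<phi> n) \<le> 1"
    "\<And>x. norm x \<le> (1 / c + \<epsilon>) * (SUP n. \<bar>blinfun_apply (\<phi> n) x\<bar>)"
    using LKK_star_norming_sequence[OF assms(4,3,1,2) \<open>\<epsilon> > 0\<close>] by blast
  have "1 / c + \<epsilon> > 0" using assms(1) \<open>\<epsilon> > 0\<close> by (simp add: add_pos_pos)
  then obtain E where "c0_linear_subspace E" "c0_closed E"
    "bm_dist_c0 TYPE('a) E \<le> ereal (1 / c + \<epsilon>)"
    using c0_embedding_of_norming_sequence[OF \<phi>] by blast
  \<comment> \<open>The construction achieves distortion \<open>1 / c + \<epsilon>\<close>;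
    \<open>c \<le> 1\<close> weakens this to the stated bound.\<close>
  moreover have "1 / c \<le> 1 / c\<^sup>2"
    using assms(1,2) by (simp add: field_simps power2_eq_square)
  then have "ereal (1 / c + \<epsilon>) \<le> ereal (1 / c\<^sup>2 + \<epsilon>)" by simp
  ultimately show "\<exists>E. c0_linear_subspace E \<and> c0_closed E \<and>
      bm_dist_c0 TYPE('a) E \<le> ereal (1 / c^2 + \<epsilon>)"
    by (meson order_trans)
qed

end
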